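(* Let $C \subseteq \mathbb{R}^2$ consist of the five points $$c_1 = (-1, -1), \quad c_2 = (1, -1), \quad c_3 = (0, 2), \quad c_1' = (0, 1.1), \quad c_2' = (0, -1.1).$$ Then for any $v \in \mathbb{R}^2$, we have $$\frac{1}{3}D_{\{c_1,c_2,c_3\}}(v) \geq \frac{1}{2}D_{\{c_1',c_2'\}}(v).$$ In particular, the ordering $(c_1, c_2, c_1', c_3, c_2')$ of $C$ is protrusive but is not in $\Psi(C)$.
   Context: Given a point $x \in \mathbb{R}^d$ and a finite multiset $V = \{v_1, \ldots, v_k\}$ of points in $\mathbb{R}^d$, let $D_V(x) = \sum_{i=1}^{k}\lVert x-v_i\rVert$ be the sum of the Euclidean distances of $x$ to the points of $V$ (counted with multiplicity). Given a finite set $C = \{a_1, \ldots, a_n\} \subseteq \mathbb{R}^d$ of $n$ distinct points and a permutation $\sigma \in S_n$, the ordering $(a_{\sigma(1)}, \ldots, a_{\sigma(n)})$ of $C$ is said to be witnessed by $V$ if $D_V(a_{\sigma(1)}) < \cdots < D_V(a_{\sigma(n)})$. The set of orderings of $C$ witnessed by some finite multiset of points in $\mathbb{R}^d$ is denoted by $\Psi(C)$. An ordering $(a_{\sigma(1)}, \ldots, a_{\sigma(n)})$ of $C$ is called protrusive if $a_{\sigma(i+1)}$ lies outside the convex hull of $a_{\sigma(1)}, \ldots, a_{\sigma(i)}$ for all $1 \leq i \leq n-1$. *)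

theory Defs
  imports "HOL-Analysis.Analysis" "HOL-Combinatorics.Multiset_Permutations"
begin

definition dist_sum :: "(real ^ 'd) multiset \<Rightarrow> real ^ 'd \<Rightarrow> real" where
  "dist_sum V x = (\<Sum>v\<in>#V. norm (x - v))"

text \<open>
  An ordering of a finite set \<open>C\<close> is a list in \<open>permutations_of_set C\<close>, i.e. one that
  enumerates \<open>C\<close> without repetition.
\<close>

definition witnessed_by :: "(real ^ 'd) list \<Rightarrow> (real ^ 'd) multiset \<Rightarrow> bool" where
  "witnessed_by as V \<longleftrightarrow> sorted_wrt (<) (map (dist_sum V) as)"

definition Psi :: "(real ^ 'd) set \<Rightarrow> (real ^ 'd) list set" where
  "Psi C = {as \<in> permutations_of_set C. \<exists>V. witnessed_by as V}"

text \<open>Lists are indexed from 0, so \<open>as ! i\<close> is the point $a_{\sigma(i+1)}$.\<close>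

definition protrusive :: "(real ^ 'd) set \<Rightarrow> (real ^ 'd) list \<Rightarrow> bool" where
  "protrusive C as \<longleftrightarrow> as \<in> permutations_of_set C \<and>
     (\<forall>i. 1 \<le> i \<and> i < length as \<longrightarrow> as ! i \<notin> convex hull (set (take i as)))"

end

theory Submission
  imports Defs
begin

text \<open>
  For the inequality, fix a point \<open>v\<close> and use the elliptic coordinates with foci
  \<open>c1' = (0, 11/10)\<close> and \<open>c2' = (0, -11/10)\<close>: the distances from \<open>v\<close> to the foci are
  \<open>\<beta> - 11/10 \<sigma>\<close> and \<open>\<beta> + 11/10 \<sigma>\<close>, where \<open>\<bar>\<sigma>\<bar> \<le> 1\<close>. Every point \<open>(0, h)\<close> then has
  squared distance \<open>(\<beta> - h \<sigma>)\<^sup>2 + (h\<^sup>2 - 121/100) (1 - \<sigma>\<^sup>2)\<close> from \<open>v\<close>. Hence the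
  distance \<open>e\<close> to \<open>c3 = (0, 2)\<close> exceeds \<open>\<beta> - 2 \<sigma>\<close>, the squares differing by
  \<open>279/100 (1 - \<sigma>\<^sup>2)\<close>, while the distance \<open>p\<close> to the midpoint \<open>(0, -1)\<close> of \<open>c1\<close> and
  \<open>c2\<close> falls short of \<open>\<beta> + \<sigma>\<close>, but the squares differ only by \<open>21/100 (1 - \<sigma>\<^sup>2)\<close>.
  The main terms of \<open>2 p + e\<close> add up to \<open>3 \<beta>\<close>, and the gain outweighs the loss as soon as \<open>\<beta> + \<sigma> \<ge> 1\<close>
  (lemma \<open>elliptic_gain_exceeds_loss\<close>). By the triangle inequality
  the distances to \<open>c1\<close> and \<open>c2\<close> add up to at least \<open>2 p\<close>, which settles this case. They also add
  up to at least \<open>norm (c1 - c2) = 2\<close>, and with \<open>e \<ge> \<beta> - 2 \<sigma>\<close> this settles the case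
  \<open>\<beta> + \<sigma> \<le> 1\<close>.

  Summing the inequality over \<open>v\<close> in a multiset \<open>V\<close> bounds the mean of \<open>D\<^sub>V\<close> over
  \<open>c1, c2, c3\<close> from below by its mean over \<open>c1', c2'\<close>. The ordering \<open>c1, c2, c1', c3, c2'\<close>
  would make the first mean strictly smaller than the second, so it is not witnessed. It is
  protrusive because each of its points after the first is separated from the preceding ones by a horizontal or vertical line.
\<close>

lemma norm_real2_sq: "(norm (v :: real ^ 2))\<^sup>2 = (v $ 1)\<^sup>2 + (v $ 2)\<^sup>2"
  unfolding power2_norm_eq_inner by (simp add: inner_vec_def sum_2 power2_eq_square)

lemma norm_real2_eqI:
  assumes "(v $ 1)\<^sup>2 + (v $ 2)\<^sup>2 = r\<^sup>2" "0 \<le> r"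
  shows "norm (v :: real ^ 2) = r"
  using assms norm_real2_sq[of v] by (metis norm_ge_zero power2_eq_imp_eq)

text \<open>
  With foci \<open>(0, f)\<close> and \<open>(0, - f)\<close>, at distances \<open>s = \<beta> - f \<sigma>\<close> and \<open>t = \<beta> + f \<sigma>\<close>,
  one has \<open>t\<^sup>2 - s\<^sup>2 = 4 f v\<^sub>2\<close> and \<open>s\<^sup>2 + t\<^sup>2 = 2 (norm v)\<^sup>2 + 2 f\<^sup>2\<close>, so that
  \<open>v\<^sub>2 = \<beta> \<sigma>\<close> and \<open>(norm v)\<^sup>2 = \<beta>\<^sup>2 - f\<^sup>2 (1 - \<sigma>\<^sup>2)\<close>.
\<close>
lemma dist_axis_point_elliptic:
  fixes v :: "real ^ 2" and f h :: real
  assumes "0 < f"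
  defines "s \<equiv> norm (v - vector [0, f])" and "t \<equiv> norm (v - vector [0, - f])"
  defines "\<beta> \<equiv> (s + t) / 2" and "\<sigma> \<equiv> (t - s) / (2 * f)"
  shows "(norm (v - vector [0, h]))\<^sup>2 = (\<beta> - h * \<sigma>)\<^sup>2 + (h\<^sup>2 - f\<^sup>2) * (1 - \<sigma>\<^sup>2)"
proof -
  have s: "s\<^sup>2 = (v $ 1)\<^sup>2 + (v $ 2 - f)\<^sup>2" and t: "t\<^sup>2 = (v $ 1)\<^sup>2 + (v $ 2 + f)\<^sup>2"
    unfolding s_def t_def by (simp_all add: norm_real2_sq)
  have ts: "s = \<beta> - f * \<sigma>" "t = \<beta> + f * \<sigma>"
    using assms(1) by (simp_all add: \<beta>_def \<sigma>_def field_simps)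
  have "4 * f * (v $ 2) = t\<^sup>2 - s\<^sup>2"
    unfolding s t by (simp add: power2_eq_square algebra_simps)
  also have "\<dots> = 4 * f * (\<beta> * \<sigma>)"
    unfolding ts by (simp add: power2_eq_square algebra_simps)
  finally have y: "v $ 2 = \<beta> * \<sigma>"
    using assms(1) by simp
  have "2 * ((v $ 1)\<^sup>2 + (v $ 2)\<^sup>2 + f\<^sup>2) = s\<^sup>2 + t\<^sup>2"
    unfolding s t by (simp add: power2_eq_square algebra_simps)
  also have "\<dots> = 2 * (\<beta>\<^sup>2 + f\<^sup>2 * \<sigma>\<^sup>2)"
    unfolding ts by (simp add: power2_eq_square algebra_simps)
  finally have r: "(v $ 1)\<^sup>2 + (v $ 2)\<^sup>2 = \<beta>\<^sup>2 + f\<^sup>2 * \<sigma>\<^sup>2 - f\<^sup>2"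
    by simp
  have "(norm (v - vector [0, h]))\<^sup>2 = (v $ 1)\<^sup>2 + (v $ 2)\<^sup>2 - 2 * h * (v $ 2) + h\<^sup>2"
    unfolding norm_real2_sq by (simp add: power2_eq_square algebra_simps)
  also have "\<dots> = (\<beta> - h * \<sigma>)\<^sup>2 + (h\<^sup>2 - f\<^sup>2) * (1 - \<sigma>\<^sup>2)"
    unfolding r unfolding y by (simp add: power2_eq_square algebra_simps)
  finally show ?thesis .
qed

text \<open>
  Write \<open>P = \<beta> + \<sigma>\<close> and \<open>E = \<beta> - 2 \<sigma>\<close>, so that \<open>3 \<beta> = 2 P + E\<close>. Factoring the differences of
  squares, the loss is \<open>2 (P - p) = 42/100 (1 - \<sigma>\<^sup>2) / (P + p)\<close> and the gain is
  \<open>e - E = 279/100 (1 - \<sigma>\<^sup>2) / (e + E)\<close>. Since \<open>e + E\<close> exceeds \<open>P + p\<close> by at most \<open>6\<close>, the gain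
  is larger unless \<open>P + p\<close> is small, which \<open>P \<ge> 1\<close> excludes.
\<close>
lemma elliptic_gain_exceeds_loss:
  fixes \<beta> \<sigma> p e :: real
  assumes "0 \<le> p" "0 \<le> e" "\<bar>\<sigma>\<bar> \<le> 1" "1 \<le> \<beta> + \<sigma>" "e \<le> p + 3"
    and p: "p\<^sup>2 = (\<beta> + \<sigma>)\<^sup>2 - 21/100 * (1 - \<sigma>\<^sup>2)"
    and e: "e\<^sup>2 = (\<beta> - 2 * \<sigma>)\<^sup>2 + 279/100 * (1 - \<sigma>\<^sup>2)"
  shows "3 * \<beta> \<le> 2 * p + e"
proof (rule ccontr)
  assume neg: "\<not> 3 * \<beta> \<le> 2 * p + e"
  define P E where "P = \<beta> + \<sigma>" and "E = \<beta> - 2 * \<sigma>"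
  define w where "w = 1 - \<sigma>\<^sup>2"
  have w: "0 \<le> w" "w \<le> 1"
    using assms(3) by (auto simp: w_def abs_square_le_1)
  have loss: "(P - p) * (P + p) = 21/100 * w"
    using p by (simp add: P_def w_def power2_eq_square field_simps)
  have gain: "(e - E) * (e + E) = 279/100 * w"
    using e by (simp add: E_def w_def power2_eq_square field_simps)
  have "E\<^sup>2 \<le> e\<^sup>2"
    using e w by (simp add: E_def w_def)
  then have "\<bar>E\<bar> \<le> e"
    using \<open>0 \<le> e\<close> by (simp add: abs_le_square_iff[symmetric])
  then have E: "E \<le> e" "0 \<le> e + E"
    by auto
  have less: "e - E < 2 * (P - p)"
    using neg by (simp add: P_def E_def)
  then have pos: "0 < P - p"
    using E by simp
  have "1 \<le> P\<^sup>2"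
    using assms(4) by (simp add: P_def)
  \<comment> \<open>\<open>p\<^sup>2 \<ge> 1 - 21/100\<close>, and \<open>88/100\<close> is just below the root of \<open>79/100\<close>\<close>
  then have "(88/100)\<^sup>2 \<le> p\<^sup>2"
    using p w(2) by (simp add: P_def flip: w_def) (simp add: power2_eq_square)
  then have "88/100 \<le> p"
    using \<open>0 \<le> p\<close> power2_le_imp_le by blast
  then have small: "42 * (e + E) < 279 * (P + p)"
    using assms(3-5) unfolding P_def E_def by argo
  have "279 * ((P - p) * (P + p)) = 21 * ((e - E) * (e + E))"
    unfolding loss gain by simp
  also have "\<dots> \<le> 21 * (2 * (P - p) * (e + E))"
    using less E by (intro mult_left_mono mult_right_mono) auto
  also have "\<dots> = (P - p) * (42 * (e + E))"
    by (simp add: algebra_simps)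
  also have "\<dots> < (P - p) * (279 * (P + p))"
    using small pos by (rule mult_strict_left_mono)
  finally show False
    by (simp add: algebra_simps)
qed

lemma mean_distance_ineq:
  fixes v :: "real ^ 2"
  shows "1 / 2 * (norm (v - vector [0, 11/10]) + norm (v - vector [0, - (11/10)]))
    \<le> 1 / 3 * (norm (v - vector [-1, -1]) + norm (v - vector [1, -1]) + norm (v - vector [0, 2]))"
proof -
  define s t where "s = norm (v - vector [0, 11/10])" and "t = norm (v - vector [0, - (11/10)])"
  define \<beta> \<sigma> where "\<beta> = (s + t) / 2" and "\<sigma> = (t - s) / (2 * (11/10))"
  define a b where "a = norm (v - vector [-1, -1])" and "b = norm (v - vector [1, -1])"
  define p e where "p = norm (v - vector [0, -1])" and "e = norm (v - vector [0, 2])"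
  note elliptic = dist_axis_point_elliptic
    [where f = "11/10" and v = v, folded s_def t_def, folded \<beta>_def \<sigma>_def]
  have p: "p\<^sup>2 = (\<beta> + \<sigma>)\<^sup>2 - 21/100 * (1 - \<sigma>\<^sup>2)"
    using elliptic[of "-1"] by (simp add: p_def power2_eq_square)
  have e: "e\<^sup>2 = (\<beta> - 2 * \<sigma>)\<^sup>2 + 279/100 * (1 - \<sigma>\<^sup>2)"
    using elliptic[of 2] by (simp add: e_def power2_eq_square)
  have "norm (vector [0, 11/10] - vector [0, - (11/10)] :: real ^ 2) = 22/10"
    by (rule norm_real2_eqI) (auto simp: power2_eq_square)
  then have "\<bar>t - s\<bar> \<le> 22/10"
    using norm_triangle_ineq3[of "v - vector [0, - (11/10)]" "v - vector [0, 11/10]"]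
    by (simp add: s_def t_def)
  then have \<sigma>: "\<bar>\<sigma>\<bar> \<le> 1"
    unfolding \<sigma>_def abs_le_iff by (simp add: field_simps)
  have "3 * \<beta> \<le> a + b + e"
  proof (cases "1 \<le> \<beta> + \<sigma>")
    case True
    have "norm (vector [0, -1] - vector [0, 2] :: real ^ 2) = 3"
      by (rule norm_real2_eqI) (auto simp: power2_eq_square)
    then have "e \<le> p + 3"
      using norm_triangle_ineq[of "v - vector [0, -1]" "vector [0, -1] - vector [0, 2]"]
      by (simp add: p_def e_def)
    then have "3 * \<beta> \<le> 2 * p + e"
      using elliptic_gain_exceeds_loss[OF _ _ \<sigma> True _ p e] by (simp add: p_def e_def)
    moreover have "(v - vector [-1, -1]) + (v - vector [1, -1]) = 2 *\<^sub>R (v - vector [0, -1])"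
      by (simp add: vec_eq_iff forall_2)
    then have "2 * p \<le> a + b"
      using norm_triangle_ineq[of "v - vector [-1, -1]" "v - vector [1, -1]"]
      by (simp add: p_def a_def b_def)
    ultimately show ?thesis
      by simp
  next
    case False
    have "norm (vector [1, -1] - vector [-1, -1] :: real ^ 2) = 2"
      by (rule norm_real2_eqI) (auto simp: power2_eq_square)
    then have "2 \<le> a + b"
      using norm_triangle_ineq4[of "v - vector [-1, -1]" "v - vector [1, -1]"]
      by (simp add: a_def b_def)
    moreover have "(\<beta> - 2 * \<sigma>)\<^sup>2 \<le> e\<^sup>2"
      using e \<sigma> by (simp add: abs_square_le_1)
    then have "\<beta> - 2 * \<sigma> \<le> e"
      by (rule power2_le_imp_le) (simp add: e_def)
    ultimately show ?thesis
      using False by simp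
  qed
  then show ?thesis
    by (simp add: \<beta>_def s_def t_def a_def b_def e_def)
qed

lemma not_in_convex_hull_if_separated:
  fixes x a :: "'a :: real_inner"
  assumes "\<forall>u\<in>S. a \<bullet> u \<le> r" "r < a \<bullet> x"
  shows "x \<notin> convex hull S"
proof -
  have "convex hull S \<subseteq> {u. a \<bullet> u \<le> r}"
    using assms(1) by (intro hull_minimal convex_halfspace_le) auto
  then show ?thesis
    using assms(2) by auto
qed

text \<open>
  A linear combination of point distances that is nonnegative at every single \<open>v\<close> stays so
  after summation over a multiset, since \<open>dist_sum\<close> is additive in its multiset and the distance
  is symmetric.
\<close>
lemma dist_sum_mean_ineq:
  fixes a b c p q :: "real ^ 'd"
  assumes "\<And>v. 1 / 2 * dist_sum {#p, q#} v \<le> 1 / 3 * dist_sum {#a, b, c#} v"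
  shows "1 / 2 * (dist_sum V p + dist_sum V q)
    \<le> 1 / 3 * (dist_sum V a + dist_sum V b + dist_sum V c)"
proof (induction V)
  case empty
  show ?case
    by (simp add: dist_sum_def)
next
  case (add v V)
  have "dist_sum (add_mset v V) x = norm (v - x) + dist_sum V x" for x
    by (simp add: dist_sum_def norm_minus_commute)
  then show ?case
    using add.IH assms[of v] by (simp add: dist_sum_def)
qed

theorem proposition1p1:
  fixes c1 c2 c3 c1' c2' :: "real ^ 2" and C :: "(real ^ 2) set"
  assumes "c1 = vector [-1, -1]" and "c2 = vector [1, -1]" and "c3 = vector [0, 2]"
    and "c1' = vector [0, 1.1]" and "c2' = vector [0, -1.1]"
    and "C = {c1, c2, c3, c1', c2'}"
  shows "(\<forall>v. 1 / 3 * dist_sum {#c1, c2, c3#} v \<ge> 1 / 2 * dist_sum {#c1', c2'#} v) \<and>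
    protrusive C [c1, c2, c1', c3, c2'] \<and> [c1, c2, c1', c3, c2'] \<notin> Psi C"
proof (intro conjI)
  have ineq: "1 / 2 * dist_sum {#c1', c2'#} v \<le> 1 / 3 * dist_sum {#c1, c2, c3#} v" for v
    using mean_distance_ineq[of v] by (simp add: dist_sum_def assms(1-5) algebra_simps)
  then show "\<forall>v. 1 / 3 * dist_sum {#c1, c2, c3#} v \<ge> 1 / 2 * dist_sum {#c1', c2'#} v"
    by blast

  let ?as = "[c1, c2, c1', c3, c2']"
  have "distinct ?as"
    by (simp add: assms(1-5) vec_eq_iff forall_2)
  then have "?as \<in> permutations_of_set C"
    by (auto simp: permutations_of_set_def assms(6))
  moreover have "?as ! i \<notin> convex hull (set (take i ?as))" if "1 \<le> i" "i < length ?as" for i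
  proof -
    have "c2 \<notin> convex hull {c1}"
      by (rule not_in_convex_hull_if_separated[where a = "axis 1 1" and r = 0])
        (simp_all add: assms(1-5) inner_axis')
    moreover have "c1' \<notin> convex hull {c1, c2}"
      by (rule not_in_convex_hull_if_separated[where a = "axis 2 1" and r = 0])
        (simp_all add: assms(1-5) inner_axis')
    moreover have "c3 \<notin> convex hull {c1, c2, c1'}"
      by (rule not_in_convex_hull_if_separated[where a = "axis 2 1" and r = "1.1"])
        (simp_all add: assms(1-5) inner_axis')
    moreover have "c2' \<notin> convex hull {c1, c2, c1', c3}"
      by (rule not_in_convex_hull_if_separated[where a = "axis 2 (-1)" and r = 1])
        (simp_all add: assms(1-5) inner_axis')
    moreover have "i = 1 \<or> i = 2 \<or> i = 3 \<or> i = 4"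
      using that by auto
    ultimately show ?thesis
      by (auto simp: numeral_eq_Suc)
  qed
  ultimately show "protrusive C ?as"
    by (auto simp: protrusive_def)

  show "?as \<notin> Psi C"
  proof
    assume "?as \<in> Psi C"
    then obtain V where "witnessed_by ?as V"
      by (auto simp: Psi_def)
    \<comment> \<open>The ordering gives \<open>2 D c1 + D c2 < 3 D c1'\<close> and \<open>D c2 + 2 D c3 < 3 D c2'\<close>; add these.\<close>
    then show False
      using dist_sum_mean_ineq[OF ineq, of V] by (simp add: witnessed_by_def)
  qed
qed

end
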